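(* Let $(Q_1,* )$ and $(Q_2,\circ)$ be right-orderable quandles, equipped with right-orders $<_1$ and $<_2$ respectively, and let $\sigma:Q_1\to\operatorname{Conj}_{-1}(\operatorname{Aut}(Q_2))$ and $\tau:Q_2\to\operatorname{Conj}_{-1}(\operatorname{Aut}(Q_1))$ be order-preserving quandle actions. Suppose that (1) $\tau(z)(x)*y=\tau(\sigma(y)(z))(x*y)$ for all $x,y\in Q_1$ and $z\in Q_2$; (2) $\sigma(z)(x)\circ y=\sigma(\tau(y)(z))(x\circ y)$ for all $x,y\in Q_2$ and $z\in Q_1$. Then the disjoint union $Q=Q_1\sqcup Q_2$ with the operation $x\star y=x*y$ if $x,y\in Q_1$; $x\star y=x\circ y$ if $x,y\in Q_2$; $x\star y=\tau(y)(x)$ if $x\in Q_1$, $y\in Q_2$; $x\star y=\sigma(y)(x)$ if $x\in Q_2$, $y\in Q_1$, is a right-orderable quandle.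
   Context: A quandle is a non-empty set $Q$ with a binary operation $*$ such that $x*x=x$; for all $x,y$ there is a unique $z$ with $x=z*y$; and $(x*y)*z=(x*z)*(y*z)$. A right-order on a quandle is a (strict) linear order $<$ such that $x<y$ implies $x*z<y*z$ for all $x,y,z$; a quandle admitting one is right-orderable. $\operatorname{Aut}(Q)$ is the group of quandle automorphisms of $Q$ under composition. For a group $G$, $\operatorname{Conj}_{-1}(G)$ is the quandle on $G$ with operation $x*y=yxy^{-1}$. An action of a quandle $Q$ on a quandle $X$ is a quandle homomorphism $\phi:Q\to\operatorname{Conj}_{-1}(\operatorname{Aut}(X))$; it is order-preserving (with respect to a linear order on $X$) if each automorphism $\phi(q)$, $q\in Q$, preserves the order of $X$. *)

theory Defs
  imports "HOL-Algebra.Bij"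
begin

record 'a binar = "'a partial_object" +
  qop :: "'a \<Rightarrow> 'a \<Rightarrow> 'a"  (infixl "\<triangleright>\<index>" 70)

locale quandle =
  fixes Q :: "('a, 'm) binar_scheme" (structure)
  assumes nonempty: "carrier Q \<noteq> {}"
    and closed [simp, intro]:
      "\<lbrakk>x \<in> carrier Q; y \<in> carrier Q\<rbrakk> \<Longrightarrow> x \<triangleright> y \<in> carrier Q"
    and idem: "x \<in> carrier Q \<Longrightarrow> x \<triangleright> x = x"
    and right_divisible:
      "\<lbrakk>x \<in> carrier Q; y \<in> carrier Q\<rbrakk> \<Longrightarrow> \<exists>!z. z \<in> carrier Q \<and> x = z \<triangleright> y"
    and right_distrib:
      "\<lbrakk>x \<in> carrier Q; y \<in> carrier Q; z \<in> carrier Q\<rbrakk>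
        \<Longrightarrow> (x \<triangleright> y) \<triangleright> z = (x \<triangleright> z) \<triangleright> (y \<triangleright> z)"

definition strict_linorder_on :: "'a set \<Rightarrow> ('a \<Rightarrow> 'a \<Rightarrow> bool) \<Rightarrow> bool" where
  "strict_linorder_on A lt \<longleftrightarrow> irreflp_on A lt \<and> transp_on A lt \<and> totalp_on A lt"

definition right_order :: "('a, 'm) binar_scheme \<Rightarrow> ('a \<Rightarrow> 'a \<Rightarrow> bool) \<Rightarrow> bool" where
  "right_order Q lt \<longleftrightarrow>
     strict_linorder_on (carrier Q) lt \<and>
     (\<forall>x \<in> carrier Q. \<forall>y \<in> carrier Q. \<forall>z \<in> carrier Q.
        lt x y \<longrightarrow> lt (x \<triangleright>\<^bsub>Q\<^esub> z) (y \<triangleright>\<^bsub>Q\<^esub> z))"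

definition right_orderable :: "('a, 'm) binar_scheme \<Rightarrow> bool" where
  "right_orderable Q \<longleftrightarrow> (\<exists>lt. right_order Q lt)"

definition quandle_hom ::
  "('a, 'm) binar_scheme \<Rightarrow> ('b, 'n) binar_scheme \<Rightarrow> ('a \<Rightarrow> 'b) set" where
  "quandle_hom Q R =
     {h \<in> carrier Q \<rightarrow> carrier R.
        \<forall>x \<in> carrier Q. \<forall>y \<in> carrier Q. h (x \<triangleright>\<^bsub>Q\<^esub> y) = h x \<triangleright>\<^bsub>R\<^esub> h y}"

text \<open>As for \<^const>\<open>AutoGroup\<close>, automorphisms are extensional functions on the carrier;
  the product of \<open>g\<close> and \<open>f\<close> applies \<open>f\<close> first.\<close>

definition quandle_auto :: "('a, 'm) binar_scheme \<Rightarrow> ('a \<Rightarrow> 'a) set" where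
  "quandle_auto Q = quandle_hom Q Q \<inter> Bij (carrier Q)"

definition quandle_Aut :: "('a, 'm) binar_scheme \<Rightarrow> ('a \<Rightarrow> 'a) monoid" where
  "quandle_Aut Q = BijGroup (carrier Q) \<lparr>carrier := quandle_auto Q\<rparr>"

definition Conj_minus1 :: "('g, 'k) monoid_scheme \<Rightarrow> 'g binar" where
  "Conj_minus1 G =
     \<lparr>carrier = carrier G, qop = (\<lambda>x y. y \<otimes>\<^bsub>G\<^esub> x \<otimes>\<^bsub>G\<^esub> inv\<^bsub>G\<^esub> y)\<rparr>"

definition quandle_action ::
  "('a, 'm) binar_scheme \<Rightarrow> ('b, 'n) binar_scheme \<Rightarrow> ('a \<Rightarrow> 'b \<Rightarrow> 'b) \<Rightarrow> bool" where
  "quandle_action Q X \<phi> \<longleftrightarrow> \<phi> \<in> quandle_hom Q (Conj_minus1 (quandle_Aut X))"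

definition order_preserving_action ::
  "('a, 'm) binar_scheme \<Rightarrow> ('b, 'n) binar_scheme \<Rightarrow> ('b \<Rightarrow> 'b \<Rightarrow> bool)
     \<Rightarrow> ('a \<Rightarrow> 'b \<Rightarrow> 'b) \<Rightarrow> bool" where
  "order_preserving_action Q X lt \<phi> \<longleftrightarrow>
     quandle_action Q X \<phi> \<and>
     (\<forall>q \<in> carrier Q. monotone_on (carrier X) lt lt (\<phi> q))"

fun union_op ::
  "('a, 'm) binar_scheme \<Rightarrow> ('b, 'n) binar_scheme
     \<Rightarrow> ('a \<Rightarrow> 'b \<Rightarrow> 'b) \<Rightarrow> ('b \<Rightarrow> 'a \<Rightarrow> 'a) \<Rightarrow> 'a + 'b \<Rightarrow> 'a + 'b \<Rightarrow> 'a + 'b" where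
  "union_op Q1 Q2 \<sigma> \<tau> (Inl x) (Inl y) = Inl (x \<triangleright>\<^bsub>Q1\<^esub> y)"
| "union_op Q1 Q2 \<sigma> \<tau> (Inr x) (Inr y) = Inr (x \<triangleright>\<^bsub>Q2\<^esub> y)"
| "union_op Q1 Q2 \<sigma> \<tau> (Inl x) (Inr y) = Inl (\<tau> y x)"
| "union_op Q1 Q2 \<sigma> \<tau> (Inr x) (Inl y) = Inr (\<sigma> y x)"

definition union_quandle ::
  "('a, 'm) binar_scheme \<Rightarrow> ('b, 'n) binar_scheme
     \<Rightarrow> ('a \<Rightarrow> 'b \<Rightarrow> 'b) \<Rightarrow> ('b \<Rightarrow> 'a \<Rightarrow> 'a) \<Rightarrow> ('a + 'b) binar" where
  "union_quandle Q1 Q2 \<sigma> \<tau> =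
     \<lparr>carrier = carrier Q1 <+> carrier Q2, qop = union_op Q1 Q2 \<sigma> \<tau>\<rparr>"

lemma (in quandle) group_quandle_Aut: "group (quandle_Aut Q)"
proof -
  have "subgroup (quandle_auto Q) (BijGroup (carrier Q))"
  proof (rule subgroup.intro)
    show "quandle_auto Q \<subseteq> carrier (BijGroup (carrier Q))"
      by (auto simp: quandle_auto_def BijGroup_def)
  next
    fix f g assume fg: "f \<in> quandle_auto Q" "g \<in> quandle_auto Q"
    have B: "f \<in> Bij (carrier Q)" "g \<in> Bij (carrier Q)"
      using fg by (auto simp: quandle_auto_def)
    have "compose (carrier Q) f g \<in> quandle_hom Q Q"
      using fg by (auto simp: quandle_auto_def quandle_hom_def compose_def Pi_iff)
    then show "f \<otimes>\<^bsub>BijGroup (carrier Q)\<^esub> g \<in> quandle_auto Q"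
      using B by (simp add: BijGroup_def quandle_auto_def compose_Bij)
  next
    show "\<one>\<^bsub>BijGroup (carrier Q)\<^esub> \<in> quandle_auto Q"
      by (auto simp: BijGroup_def quandle_auto_def quandle_hom_def id_Bij)
  next
    fix f assume f: "f \<in> quandle_auto Q"
    then have B: "f \<in> Bij (carrier Q)"
      and h: "\<And>x y. \<lbrakk>x \<in> carrier Q; y \<in> carrier Q\<rbrakk> \<Longrightarrow> f (x \<triangleright> y) = f x \<triangleright> f y"
      by (auto simp: quandle_auto_def quandle_hom_def)
    have "inv_into (carrier Q) f (x \<triangleright> y)
            = inv_into (carrier Q) f x \<triangleright> inv_into (carrier Q) f y"
      if "x \<in> carrier Q" "y \<in> carrier Q" for x y
      by (rule Bij_inv_into_lemma[of "carrier Q" f "qop Q"]) (use h B that in auto)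
    then have "restrict (inv_into (carrier Q) f) (carrier Q) \<in> quandle_hom Q Q"
      using B by (auto simp: quandle_hom_def Bij_inv_into_mem)
    then show "inv\<^bsub>BijGroup (carrier Q)\<^esub> f \<in> quandle_auto Q"
      using B by (simp add: inv_BijGroup quandle_auto_def restrict_inv_into_Bij)
  qed
  then show ?thesis
    unfolding quandle_Aut_def
    by (rule subgroup.subgroup_is_group[OF _ group_BijGroup])
qed

lemma (in group) quandle_Conj_minus1: "quandle (Conj_minus1 G)"
proof -
  have c: "y \<otimes> (inv y \<otimes> w) = w" "inv y \<otimes> (y \<otimes> w) = w"
    if "y \<in> carrier G" "w \<in> carrier G" for y w
    using that by (simp_all add: m_assoc[symmetric])
  show ?thesis
  proof
    show "\<exists>!z. z \<in> carrier (Conj_minus1 G) \<and> x = z \<triangleright>\<^bsub>Conj_minus1 G\<^esub> y"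
      if "x \<in> carrier (Conj_minus1 G)" "y \<in> carrier (Conj_minus1 G)" for x y
    proof (rule ex1I[of _ "inv y \<otimes> x \<otimes> y"])
      show "inv y \<otimes> x \<otimes> y \<in> carrier (Conj_minus1 G) \<and>
          x = (inv y \<otimes> x \<otimes> y) \<triangleright>\<^bsub>Conj_minus1 G\<^esub> y"
        using that by (simp add: Conj_minus1_def m_assoc c)
    next
      fix z assume "z \<in> carrier (Conj_minus1 G) \<and> x = z \<triangleright>\<^bsub>Conj_minus1 G\<^esub> y"
      then show "z = inv y \<otimes> x \<otimes> y"
        using that by (simp add: Conj_minus1_def m_assoc c)
    qed
  qed (auto simp: Conj_minus1_def m_assoc inv_mult_group c)
qed

end

theory Submission
  imports Defs
begin

text \<open>The self-distributive law of the union splits by which summands \<open>x, y, z\<close> lie in. With all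
  three in one summand it is the law there; with only \<open>z\<close> apart it says that actions are by
  automorphisms; with only \<open>x\<close> apart it says that an action turns \<open>q \<triangleright> r\<close> into a
  conjugate; with only \<open>y\<close> apart it is one of the two compatibility conditions. Putting one
  summand entirely below the other gives a right-order, since right multiplications preserve the
  summands and are increasing on each.\<close>

text \<open>Cancelling the inverse in \<open>h \<otimes> g \<otimes> inv h\<close> leaves an
  identity between two products. In an automorphism group it can be read as an equation of
  composites, without computing an inverse map.\<close>

lemma Conj_minus1_conjugate:
  assumes "group G" "g \<in> carrier G" "h \<in> carrier G"
  shows "(g \<triangleright>\<^bsub>Conj_minus1 G\<^esub> h) \<otimes>\<^bsub>G\<^esub> h = h \<otimes>\<^bsub>G\<^esub> g"
proof -
  interpret group G by fact
  show ?thesis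
    using assms(2,3) by (simp add: Conj_minus1_def m_assoc)
qed

lemma carrier_Conj_quandle_Aut [simp]:
  "carrier (Conj_minus1 (quandle_Aut X)) = quandle_auto X"
  by (simp add: Conj_minus1_def quandle_Aut_def)

lemma quandle_action_auto:
  assumes "quandle_action Q X \<phi>" "q \<in> carrier Q"
  shows "\<phi> q \<in> quandle_auto X"
  using assms by (auto simp: quandle_action_def quandle_hom_def)

lemma quandle_action_bij_betw:
  assumes "quandle_action Q X \<phi>" "q \<in> carrier Q"
  shows "bij_betw (\<phi> q) (carrier X) (carrier X)"
  using quandle_action_auto[OF assms] by (simp add: quandle_auto_def Bij_def)

lemma quandle_action_closed:
  assumes "quandle_action Q X \<phi>" "q \<in> carrier Q" "x \<in> carrier X"
  shows "\<phi> q x \<in> carrier X"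
  using quandle_action_bij_betw[OF assms(1,2)] assms(3) by (rule bij_betwE[rule_format])

lemma quandle_action_distrib:
  assumes "quandle_action Q X \<phi>" "q \<in> carrier Q" "x \<in> carrier X" "y \<in> carrier X"
  shows "\<phi> q (x \<triangleright>\<^bsub>X\<^esub> y) = \<phi> q x \<triangleright>\<^bsub>X\<^esub> \<phi> q y"
  using quandle_action_auto[OF assms(1,2)] assms(3,4)
  by (simp add: quandle_auto_def quandle_hom_def)

text \<open>Serves as right divisibility in the union when the divisor lies in the other summand:
  bijectivity of \<open>\<phi> q\<close> gives both existence and uniqueness.\<close>

lemma quandle_action_ex1:
  assumes "quandle_action Q X \<phi>" "q \<in> carrier Q" "x \<in> carrier X"
  shows "\<exists>!z. z \<in> carrier X \<and> x = \<phi> q z"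
  using quandle_action_bij_betw[OF assms(1,2)] assms(3)
  unfolding bij_betw_def inj_on_def by blast

text \<open>Since \<open>\<phi>\<close> is a homomorphism into the conjugation quandle,
  \<open>\<phi> (q \<triangleright> r)\<close> is the conjugate of \<open>\<phi> q\<close> by
  \<open>\<phi> r\<close>. Multiplying on the right by \<open>\<phi> r\<close> and evaluating at
  \<open>x\<close> gives the claim.\<close>

lemma quandle_action_conjugate:
  assumes Q: "quandle Q" and X: "quandle X" and act: "quandle_action Q X \<phi>"
    and q: "q \<in> carrier Q" and r: "r \<in> carrier Q" and x: "x \<in> carrier X"
  shows "\<phi> r (\<phi> q x) = \<phi> (q \<triangleright>\<^bsub>Q\<^esub> r) (\<phi> r x)"
proof -
  let ?A = "quandle_Aut X"
  \<comment> \<open>The product of \<open>BijGroup\<close> is restricted to bijections, so it is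
    known to be \<open>compose\<close> only once both factors are known to lie in
    \<open>Bij\<close>.\<close>
  have mult: "f \<otimes>\<^bsub>?A\<^esub> g = compose (carrier X) f g"
    if "f \<in> quandle_auto X" "g \<in> quandle_auto X" for f g
    using that by (simp add: quandle_Aut_def BijGroup_def quandle_auto_def)
  have "\<phi> (q \<triangleright>\<^bsub>Q\<^esub> r) = \<phi> q \<triangleright>\<^bsub>Conj_minus1 ?A\<^esub> \<phi> r"
    using act q r by (simp add: quandle_action_def quandle_hom_def)
  then have "\<phi> (q \<triangleright>\<^bsub>Q\<^esub> r) \<otimes>\<^bsub>?A\<^esub> \<phi> r = \<phi> r \<otimes>\<^bsub>?A\<^esub> \<phi> q"
    using Conj_minus1_conjugate[OF quandle.group_quandle_Aut[OF X]]
      quandle_action_auto[OF act q] quandle_action_auto[OF act r]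
    by (simp add: quandle_Aut_def)
  then have "compose (carrier X) (\<phi> (q \<triangleright>\<^bsub>Q\<^esub> r)) (\<phi> r) = compose (carrier X) (\<phi> r) (\<phi> q)"
    using quandle_action_auto[OF act] q r quandle.closed[OF Q q r] by (simp add: mult)
  then show ?thesis
    using x by (metis compose_eq)
qed

lemma quandle_union_quandle:
  assumes Q1: "quandle Q1" and Q2: "quandle Q2"
    and \<sigma>: "quandle_action Q1 Q2 \<sigma>" and \<tau>: "quandle_action Q2 Q1 \<tau>"
    and compat1: "\<And>x y z. \<lbrakk>x \<in> carrier Q1; y \<in> carrier Q1; z \<in> carrier Q2\<rbrakk>
           \<Longrightarrow> \<tau> z x \<triangleright>\<^bsub>Q1\<^esub> y = \<tau> (\<sigma> y z) (x \<triangleright>\<^bsub>Q1\<^esub> y)"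
    and compat2: "\<And>x y z. \<lbrakk>x \<in> carrier Q2; y \<in> carrier Q2; z \<in> carrier Q1\<rbrakk>
           \<Longrightarrow> \<sigma> z x \<triangleright>\<^bsub>Q2\<^esub> y = \<sigma> (\<tau> y z) (x \<triangleright>\<^bsub>Q2\<^esub> y)"
  shows "quandle (union_quandle Q1 Q2 \<sigma> \<tau>)"
proof -
  interpret Q1: quandle Q1 by fact
  interpret Q2: quandle Q2 by fact
  let ?U = "union_quandle Q1 Q2 \<sigma> \<tau>"
  show ?thesis
  proof
    show "carrier ?U \<noteq> {}"
      using Q1.nonempty by (auto simp: union_quandle_def)
  next
    fix x y assume "x \<in> carrier ?U" "y \<in> carrier ?U"
    then show "x \<triangleright>\<^bsub>?U\<^esub> y \<in> carrier ?U"
      by (auto simp: union_quandle_def quandle_action_closed[OF \<sigma>] quandle_action_closed[OF \<tau>])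
  next
    fix x assume "x \<in> carrier ?U"
    then show "x \<triangleright>\<^bsub>?U\<^esub> x = x"
      by (auto simp: union_quandle_def Q1.idem Q2.idem)
  next
    fix x y assume xy: "x \<in> carrier ?U" "y \<in> carrier ?U"
    show "\<exists>!z. z \<in> carrier ?U \<and> x = z \<triangleright>\<^bsub>?U\<^esub> y"
    \<comment> \<open>A product lies in the summand of its left factor, so any solution
      \<open>z\<close> lies in the summand of \<open>x\<close>. There it is unique by divisibility
      in that quandle, or by bijectivity of the action if \<open>y\<close> is in the other
      summand.\<close>
    proof (cases x)
      case (Inl a)
      then have "\<exists>!z. z \<in> carrier Q1 \<and> Inl a = union_op Q1 Q2 \<sigma> \<tau> (Inl z) y"
        using xy by (cases y)
          (auto simp: union_quandle_def intro!: Q1.right_divisible quandle_action_ex1[OF \<tau>])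
      moreover have "Inl a \<noteq> union_op Q1 Q2 \<sigma> \<tau> (Inr z) y" for z
        by (cases y) auto
      ultimately show ?thesis
        by (auto simp: Inl union_quandle_def Ex1_def Plus_def)
    next
      case (Inr b)
      then have "\<exists>!z. z \<in> carrier Q2 \<and> Inr b = union_op Q1 Q2 \<sigma> \<tau> (Inr z) y"
        using xy by (cases y)
          (auto simp: union_quandle_def intro!: Q2.right_divisible quandle_action_ex1[OF \<sigma>])
      moreover have "Inr b \<noteq> union_op Q1 Q2 \<sigma> \<tau> (Inl z) y" for z
        by (cases y) auto
      ultimately show ?thesis
        by (auto simp: Inr union_quandle_def Ex1_def Plus_def)
    qed
  next
    fix x y z assume "x \<in> carrier ?U" "y \<in> carrier ?U" "z \<in> carrier ?U"
    then show "(x \<triangleright>\<^bsub>?U\<^esub> y) \<triangleright>\<^bsub>?U\<^esub> z = (x \<triangleright>\<^bsub>?U\<^esub> z) \<triangleright>\<^bsub>?U\<^esub> (y \<triangleright>\<^bsub>?U\<^esub> z)"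
      by (auto simp: union_quandle_def
          intro: Q1.right_distrib quandle_action_distrib[OF \<tau>] quandle_action_conjugate[OF Q2 Q1 \<tau>] compat1
            Q2.right_distrib quandle_action_distrib[OF \<sigma>] quandle_action_conjugate[OF Q1 Q2 \<sigma>] compat2)
  qed
qed

fun sum_less :: "('a \<Rightarrow> 'a \<Rightarrow> bool) \<Rightarrow> ('b \<Rightarrow> 'b \<Rightarrow> bool) \<Rightarrow> 'a + 'b \<Rightarrow> 'a + 'b \<Rightarrow> bool" where
  "sum_less lt1 lt2 (Inl x) (Inl y) = lt1 x y"
| "sum_less lt1 lt2 (Inr x) (Inr y) = lt2 x y"
| "sum_less lt1 lt2 (Inl x) (Inr y) = True"
| "sum_less lt1 lt2 (Inr x) (Inl y) = False"

lemma strict_linorder_on_sum_less: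
  assumes "strict_linorder_on A lt1" "strict_linorder_on B lt2"
  shows "strict_linorder_on (A <+> B) (sum_less lt1 lt2)"
proof -
  have "irreflp_on (A <+> B) (sum_less lt1 lt2)"
    using assms by (auto simp: strict_linorder_on_def irreflp_on_def)
  moreover have "transp_on (A <+> B) (sum_less lt1 lt2)"
  proof (rule transp_onI)
    fix x y z
    assume "x \<in> A <+> B" "y \<in> A <+> B" "z \<in> A <+> B"
      and "sum_less lt1 lt2 x y" "sum_less lt1 lt2 y z"
    then show "sum_less lt1 lt2 x z"
      \<comment> \<open>Only the two unmixed cases need transitivity of \<open>lt1\<close> or
        \<open>lt2\<close>. In a mixed case either an \<open>Inr\<close> is assumed below an
        \<open>Inl\<close>, which is false, or the conclusion compares an \<open>Inl\<close> with an
        \<open>Inr\<close>.\<close>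
      using assms by (cases x; cases y; cases z)
        (auto simp: strict_linorder_on_def elim: transp_onD)
  qed
  moreover have "totalp_on (A <+> B) (sum_less lt1 lt2)"
  proof (rule totalp_onI)
    fix x y
    assume "x \<in> A <+> B" "y \<in> A <+> B" "x \<noteq> y"
    then show "sum_less lt1 lt2 x y \<or> sum_less lt1 lt2 y x"
      using assms by (cases x; cases y) (auto simp: strict_linorder_on_def dest: totalp_onD)
  qed
  ultimately show ?thesis
    by (simp add: strict_linorder_on_def)
qed

text \<open>Within a summand, right multiplication by one of its own elements is increasing by the
  given right-order, and by an element of the other summand because the action preserves
  order.\<close>

lemma right_order_union_quandle:
  assumes "right_order Q1 lt1" and "right_order Q2 lt2"
    and "order_preserving_action Q1 Q2 lt2 \<sigma>"
    and "order_preserving_action Q2 Q1 lt1 \<tau>"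
  shows "right_order (union_quandle Q1 Q2 \<sigma> \<tau>) (sum_less lt1 lt2)"
  using assms strict_linorder_on_sum_less[of "carrier Q1" lt1 "carrier Q2" lt2]
  by (auto simp: right_order_def union_quandle_def order_preserving_action_def monotone_on_def)

theorem proposition4p3:
  fixes Q1 :: "('a, 'm) binar_scheme" and Q2 :: "('b, 'n) binar_scheme"
    and lt1 :: "'a \<Rightarrow> 'a \<Rightarrow> bool" and lt2 :: "'b \<Rightarrow> 'b \<Rightarrow> bool"
    and \<sigma> :: "'a \<Rightarrow> 'b \<Rightarrow> 'b" and \<tau> :: "'b \<Rightarrow> 'a \<Rightarrow> 'a"
  assumes "quandle Q1" and "quandle Q2"
    and "right_order Q1 lt1" and "right_order Q2 lt2"
    and "order_preserving_action Q1 Q2 lt2 \<sigma>"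
    and "order_preserving_action Q2 Q1 lt1 \<tau>"
    and "\<And>x y z. \<lbrakk>x \<in> carrier Q1; y \<in> carrier Q1; z \<in> carrier Q2\<rbrakk>
           \<Longrightarrow> \<tau> z x \<triangleright>\<^bsub>Q1\<^esub> y = \<tau> (\<sigma> y z) (x \<triangleright>\<^bsub>Q1\<^esub> y)"
    and "\<And>x y z. \<lbrakk>x \<in> carrier Q2; y \<in> carrier Q2; z \<in> carrier Q1\<rbrakk>
           \<Longrightarrow> \<sigma> z x \<triangleright>\<^bsub>Q2\<^esub> y = \<sigma> (\<tau> y z) (x \<triangleright>\<^bsub>Q2\<^esub> y)"
  shows "quandle (union_quandle Q1 Q2 \<sigma> \<tau>) \<and> right_orderable (union_quandle Q1 Q2 \<sigma> \<tau>)"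
  using assms quandle_union_quandle[of Q1 Q2 \<sigma> \<tau>]
    right_order_union_quandle[of Q1 lt1 Q2 lt2 \<sigma> \<tau>]
  by (auto simp: right_orderable_def order_preserving_action_def)

end
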